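(* Let $G$ be a group and $H$ a subgroup of $G$. Then $\operatorname{Tr}_H$ is a preradical on the category $G\text{-}\mathbf{Set}$.
   Context: $G\text{-}\mathbf{Set}$ is the category of (left) $G$-sets and $G$-equivariant maps; $G/H$ is the set of left cosets of $H$ with the left translation action. For a $G$-set $X$, the $H$-trace is the subset $\operatorname{Tr}_H(X)=\bigcup\{\operatorname{im}(\alpha)\mid \alpha\colon G/H\to X \text{ a } G\text{-equivariant map}\}$ of $X$. A preradical on a category is a subfunctor of its identity functor; for an assignment $X\mapsto r(X)\subseteq X$ on $G\text{-}\mathbf{Set}$ this means that each $r(X)$ is a $G$-subset of $X$ and that $\beta(r(X))\subseteq r(Y)$ for every $G$-equivariant map $\beta\colon X\to Y$. *)

theory Defs
  imports "HOL-Algebra.Group_Action" "HOL-Algebra.Left_Coset"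
begin

record ('a, 'x) gset =
  points :: "'x set"
  act :: "'a \<Rightarrow> 'x \<Rightarrow> 'x"

(* group_action makes every act X g extensional on points X; this only fixes the junk
   values outside of points X. *)
definition is_gset :: "('a, 'm) monoid_scheme \<Rightarrow> ('a, 'x) gset \<Rightarrow> bool" where
  "is_gset G X \<longleftrightarrow> group_action G (points X) (act X)"

definition equivariant_maps ::
  "('a, 'm) monoid_scheme \<Rightarrow> ('a, 'x) gset \<Rightarrow> ('a, 'y) gset \<Rightarrow> ('x \<Rightarrow> 'y) set" where
  "equivariant_maps G X Y =
     {f \<in> points X \<rightarrow> points Y.
        \<forall>g\<in>carrier G. \<forall>x\<in>points X. f (act X g x) = act Y g (f x)}"

definition gsubset :: "('a, 'm) monoid_scheme \<Rightarrow> ('a, 'x) gset \<Rightarrow> 'x set \<Rightarrow> bool" where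
  "gsubset G X A \<longleftrightarrow> A \<subseteq> points X \<and> (\<forall>g\<in>carrier G. \<forall>a\<in>A. act X g a \<in> A)"

definition coset_gset :: "('a, 'm) monoid_scheme \<Rightarrow> 'a set \<Rightarrow> ('a, 'a set) gset" where
  "coset_gset G H =
     \<lparr>points = lcosets\<^bsub>G\<^esub> H, act = (\<lambda>g. \<lambda>C\<in>lcosets\<^bsub>G\<^esub> H. g <#\<^bsub>G\<^esub> C)\<rparr>"

definition trace :: "('a, 'm) monoid_scheme \<Rightarrow> 'a set \<Rightarrow> ('a, 'x) gset \<Rightarrow> 'x set" where
  "trace G H X =
     (\<Union>\<alpha>\<in>equivariant_maps G (coset_gset G H) X. \<alpha> ` points (coset_gset G H))"

(* An assignment on all G-sets is a polymorphic constant, which cannot be passed as an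
   argument. Here r and s stand for its instances at the element types 'x and 'y. *)
definition preserved_by_maps :: "('a, 'm) monoid_scheme \<Rightarrow>
    (('a, 'x) gset \<Rightarrow> 'x set) \<Rightarrow> (('a, 'y) gset \<Rightarrow> 'y set) \<Rightarrow> bool" where
  "preserved_by_maps G r s \<longleftrightarrow>
     (\<forall>X Y. is_gset G X \<longrightarrow> is_gset G Y \<longrightarrow>
        (\<forall>\<beta>\<in>equivariant_maps G X Y. \<beta> ` r X \<subseteq> s Y))"

(* Preradicals on the category of G-sets with elements in 'x. *)
definition preradical ::
  "('a, 'm) monoid_scheme \<Rightarrow> (('a, 'x) gset \<Rightarrow> 'x set) \<Rightarrow> bool" where
  "preradical G r \<longleftrightarrow>
     (\<forall>X. is_gset G X \<longrightarrow> gsubset G X (r X)) \<and> preserved_by_maps G r r"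

lemma is_gset_coset_gset:
  assumes "group G" and "subgroup H G"
  shows "is_gset G (coset_gset G H)"
proof -
  interpret group G by fact
  interpret H: subgroup H G by fact
  let ?L = "lcosets\<^bsub>G\<^esub> H"
  let ?a = "\<lambda>g. \<lambda>C\<in>?L. g <#\<^bsub>G\<^esub> C"
  have sub: "C \<subseteq> carrier G" if "C \<in> ?L" for C
    using H.lcosets_carrier[OF is_group that] .
  have cl: "g <#\<^bsub>G\<^esub> C \<in> ?L" if "g \<in> carrier G" "C \<in> ?L" for g C
    using that H.subset by (auto simp: LCOSETS_def lcos_m_assoc)
  have mult: "g <#\<^bsub>G\<^esub> (h <#\<^bsub>G\<^esub> C) = (g \<otimes>\<^bsub>G\<^esub> h) <#\<^bsub>G\<^esub> C"
    if "g \<in> carrier G" "h \<in> carrier G" "C \<in> ?L" for g h C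
    using that sub by (simp add: lcos_m_assoc)
  have one: "\<one>\<^bsub>G\<^esub> <#\<^bsub>G\<^esub> C = C" if "C \<in> ?L" for C
    using sub[OF that] by (simp add: lcos_mult_one)
  have bij: "?a g \<in> Bij ?L" if g: "g \<in> carrier G" for g
  proof -
    have "bij_betw (?a g) ?L ?L"
      by (rule bij_betwI[where g = "?a (inv\<^bsub>G\<^esub> g)"])
         (use g in \<open>auto simp: cl mult one\<close>)
    then show ?thesis
      by (simp add: Bij_def)
  qed
  have hom: "?a \<in> hom G (BijGroup ?L)"
  proof (rule homI)
    fix g assume "g \<in> carrier G"
    then show "?a g \<in> carrier (BijGroup ?L)"
      using bij by (simp add: BijGroup_def)
  next
    fix g h assume gh: "g \<in> carrier G" "h \<in> carrier G"
    have "?a (g \<otimes>\<^bsub>G\<^esub> h) = compose ?L (?a g) (?a h)"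
      using gh by (auto simp: compose_def fun_eq_iff cl mult)
    then show "?a (g \<otimes>\<^bsub>G\<^esub> h) = ?a g \<otimes>\<^bsub>BijGroup ?L\<^esub> ?a h"
      using gh bij by (simp add: BijGroup_def)
  qed
  show ?thesis
    unfolding is_gset_def coset_gset_def
    by (auto intro!: group_action.intro group_hom.intro group_hom_axioms.intro
        group_BijGroup hom is_group)
qed

end

theory Submission
  imports Defs
begin

text \<open>The trace is a union of images of equivariant maps out of G/H. Each image is a G-subset
  and unions preserve this, which gives \<open>gsubset_trace\<close>. For \<open>\<beta>\<close>
  from X to Y, each \<open>\<beta> \<circ> \<alpha>\<close> is again an equivariant map out of G/H,
  so \<open>\<beta>\<close> carries every image making up the trace of X onto one making up that of
  Y; this is \<open>image_trace_subset\<close>.\<close>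

lemma act_closed:
  assumes "is_gset G X" "g \<in> carrier G" "x \<in> points X"
  shows "act X g x \<in> points X"
  using assms group_action.element_image unfolding is_gset_def by fastforce

lemma equivariant_maps_comp:
  assumes "\<alpha> \<in> equivariant_maps G X Y" "\<beta> \<in> equivariant_maps G Y Z"
  shows "\<beta> \<circ> \<alpha> \<in> equivariant_maps G X Z"
  using assms by (auto simp: equivariant_maps_def Pi_iff)

text \<open>Equivariance rewrites a translate of \<open>\<alpha> x\<close> as the image of a
  translate of \<open>x\<close>, which stays in the domain.\<close>

lemma gsubset_image:
  assumes "is_gset G X" "\<alpha> \<in> equivariant_maps G X Y"
  shows "gsubset G Y (\<alpha> ` points X)"
proof -
  have "act Y g (\<alpha> x) \<in> \<alpha> ` points X" if "g \<in> carrier G" "x \<in> points X" for g x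
  proof
    show "act Y g (\<alpha> x) = \<alpha> (act X g x)"
      using assms(2) that by (simp add: equivariant_maps_def)
    show "act X g x \<in> points X"
      using assms(1) that by (rule act_closed)
  qed
  then show ?thesis
    using assms(2) by (auto simp: gsubset_def equivariant_maps_def)
qed

lemma gsubset_UN:
  assumes "\<And>i. i \<in> I \<Longrightarrow> gsubset G X (A i)"
  shows "gsubset G X (\<Union>i\<in>I. A i)"
  using assms unfolding gsubset_def by blast

lemma gsubset_trace:
  assumes "group G" "subgroup H G"
  shows "gsubset G X (trace G H X)"
  unfolding trace_def
  by (intro gsubset_UN gsubset_image is_gset_coset_gset assms)

lemma image_trace_subset:
  assumes "\<beta> \<in> equivariant_maps G X Y"
  shows "\<beta> ` trace G H X \<subseteq> trace G H Y"
proof -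
  have "\<beta> (\<alpha> c) \<in> trace G H Y"
    if "\<alpha> \<in> equivariant_maps G (coset_gset G H) X" "c \<in> points (coset_gset G H)" for \<alpha> c
    unfolding trace_def
  proof (rule UN_I)
    \<comment> \<open>The index in the union for Y is the composite map, with the same coset
      \<open>c\<close> as argument.\<close>
    show "\<beta> \<circ> \<alpha> \<in> equivariant_maps G (coset_gset G H) Y"
      using that(1) assms by (rule equivariant_maps_comp)
    show "\<beta> (\<alpha> c) \<in> (\<beta> \<circ> \<alpha>) ` points (coset_gset G H)"
      using that(2) by (auto simp flip: image_comp)
  qed
  then show ?thesis
    \<comment> \<open>The instantiation unfolds the trace of X and keeps that of Y folded, matching
      the fact just proved.\<close>
    by (auto simp: trace_def[of G H X])
qed

theorem proposition15:
  fixes G :: "('a, 'm) monoid_scheme" and H :: "'a set"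
  assumes "group G" and "subgroup H G"
  shows "preradical G (trace G H :: ('a, 'x) gset \<Rightarrow> 'x set) \<and>
    preserved_by_maps G (trace G H :: ('a, 'x) gset \<Rightarrow> 'x set)
      (trace G H :: ('a, 'y) gset \<Rightarrow> 'y set)"
  unfolding preradical_def preserved_by_maps_def
  \<comment> \<open>\<open>image_trace_subset\<close> is polymorphic, so it covers maps within
    \<open>'x\<close> as well as maps from \<open>'x\<close> to \<open>'y\<close>.\<close>
  by (intro conjI allI impI ballI gsubset_trace image_trace_subset assms)

end
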